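(* $T_1(4)=7$; that is, every triangle-free graph on $7$ vertices contains a $1$-sparse set of $4$ vertices, and there is a triangle-free graph on $6$ vertices containing no $1$-sparse set of $4$ vertices.
   Context: All graphs are finite and simple. A set $S$ of vertices of a graph $G$ is $k$-sparse if the induced subgraph $G[S]$ has maximum degree at most $k$. For integers $k\ge0$ and $j\ge1$, $T_k(j)$ denotes the minimum $n$ such that every triangle-free graph on $n$ vertices contains a $k$-sparse set of $j$ vertices. *)

theory Defs
  imports "Graph_Theory.Pair_Digraph" "Graph_Theory.Digraph_Component"
begin

text \<open>
  Finite simple graphs are the instances of \<^locale>\<open>pair_graph\<close>: finite, symmetric, loop-free
  digraphs whose arcs are pairs of vertices. An undirected edge \<open>uv\<close> is the pair of arcs
  \<open>(u, v)\<close>, \<open>(v, u)\<close>, so the degree of a vertex is its \<^const>\<open>out_degree\<close>.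
\<close>

text \<open>In a loop-free graph the three vertices below are automatically distinct.\<close>

definition triangle_free :: "'a pair_pre_digraph \<Rightarrow> bool" where
  "triangle_free G \<longleftrightarrow>
     \<not> (\<exists>u v w. (u, v) \<in> parcs G \<and> (v, w) \<in> parcs G \<and> (w, u) \<in> parcs G)"

definition k_sparse :: "nat \<Rightarrow> 'a pair_pre_digraph \<Rightarrow> 'a set \<Rightarrow> bool" where
  "k_sparse k G S \<longleftrightarrow>
     S \<subseteq> pverts G \<and> (\<forall>v\<in>S. out_degree (with_proj G \<restriction> S) v \<le> k)"

text \<open>
  The number \<open>T\<^sub>k(j)\<close>. Every finite graph is isomorphic to one whose vertices are natural
  numbers, so it suffices to quantify over these. \<^const>\<open>Least\<close> is unspecified if no
  \<open>n\<close> has the property.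
\<close>

definition T_num :: "nat \<Rightarrow> nat \<Rightarrow> nat" where
  "T_num k j = (LEAST n. \<forall>G :: nat pair_pre_digraph.
     pair_graph G \<and> triangle_free G \<and> card (pverts G) = n \<longrightarrow>
       (\<exists>S. k_sparse k G S \<and> card S = j))"

end

theory Submission
  imports Defs
begin

text \<open>
  In a triangle-free graph on seven vertices without a \<open>1\<close>-sparse \<open>4\<close>-set, all neighbourhoods are
  independent, so all degrees are at most \<open>3\<close>. If \<open>v\<close> has degree \<open>3\<close>, each non-neighbour of \<open>v\<close> has
  at least two of its neighbours in \<open>N(v)\<close>; hence any two non-neighbours have a common neighbour, are
  not adjacent, and together with \<open>v\<close> they form an independent \<open>4\<close>-set. If all degrees are at most
  \<open>2\<close> and \<open>v\<close> has the neighbours \<open>a\<close>, \<open>b\<close>, then the four non-neighbours contain a path \<open>y x z\<close>, and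
  one of \<open>{v, a, x, y}\<close>, \<open>{v, b, x, y}\<close> induces two disjoint edges. The lower bound comes from
  \<open>K\<^sub>3\<^sub>,\<^sub>3\<close> and its induced subgraphs.
\<close>

text \<open>This trades the degree bound for a first-order condition. Its failure on a set of
  vertices yields a vertex of the set with two distinct neighbours in the set.\<close>

lemma (in pair_graph) k_sparse_1_iff:
  "k_sparse 1 G S \<longleftrightarrow> S \<subseteq> pverts G \<and>
     (\<forall>v\<in>S. \<forall>a\<in>S. \<forall>b\<in>S. (v, a) \<in> parcs G \<longrightarrow> (v, b) \<in> parcs G \<longrightarrow> a = b)"
proof -
  have "out_degree (with_proj G \<restriction> S) v \<le> 1 \<longleftrightarrow>
      (\<forall>a\<in>S. \<forall>b\<in>S. (v, a) \<in> parcs G \<longrightarrow> (v, b) \<in> parcs G \<longrightarrow> a = b)" if "v \<in> S" for v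
  proof -
    have "out_arcs (with_proj G \<restriction> S) v = Pair v ` {a \<in> S. (v, a) \<in> parcs G}"
      using that by (auto simp: out_arcs_def)
    then have "out_degree (with_proj G \<restriction> S) v = card {a \<in> S. (v, a) \<in> parcs G}"
      by (simp add: out_degree_def card_image inj_on_def)
    moreover have "finite {a \<in> S. (v, a) \<in> parcs G}"
      by (rule finite_subset[OF _ pair_finite_verts]) (auto dest: wellformed')
    ultimately show ?thesis by (auto simp: card_le_Suc0_iff_eq)
  qed
  then show ?thesis by (auto simp: k_sparse_def)
qed

lemma (in pair_graph) ex_1_sparse_4_of_7:
  assumes tf: "triangle_free G" and card7: "card (pverts G) = 7"
  shows "\<exists>S. k_sparse 1 G S \<and> card S = 4"
proof (rule ccontr)
  assume neg: "\<not> ?thesis"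
  have path: "\<exists>v\<in>S. \<exists>a\<in>S. \<exists>b\<in>S. (v, a) \<in> parcs G \<and> (v, b) \<in> parcs G \<and> a \<noteq> b"
    if "S \<subseteq> pverts G" "card S = 4" for S
    using neg that unfolding k_sparse_1_iff by blast
  have sym: "(b, a) \<in> parcs G" if "(a, b) \<in> parcs G" for a b
    using that arcs_symmetric by blast
  have irr: "(a, a) \<notin> parcs G" for a
    using pair_no_loops by force
  have tri: "(u, w) \<notin> parcs G" if "(u, v) \<in> parcs G" "(v, w) \<in> parcs G" for u v w
    using tf that sym unfolding triangle_free_def by blast
  define N where "N v = {w. (v, w) \<in> parcs G}" for v
  have N_sub: "N v \<subseteq> pverts G" for v
    unfolding N_def using wellformed' by auto
  have fin: "finite (N v)" for v
    using N_sub pair_finite_verts finite_subset by blast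
  have indep: "(a, b) \<notin> parcs G" if "a \<in> N v" "b \<in> N v" for a b v
    using that tri sym unfolding N_def by blast
  have card_W: "card (pverts G - insert v (N v)) = 6 - card (N v)" if "v \<in> pverts G" for v
    using that N_sub[of v] fin irr card7 pair_finite_verts
    by (subst card_Diff_subset) (auto simp: N_def)
  have deg3: "card (N v) \<le> 3" for v
  proof (rule ccontr)
    assume "\<not> ?thesis"
    then obtain S where "S \<subseteq> N v" "card S = 4"
      using obtain_subset_with_card_n[of 4 "N v"] by auto
    then show False
      using path[of S] N_sub[of v] indep by blast
  qed
  have deg2: "card (N v) \<le> 2" if v: "v \<in> pverts G" for v
  proof (rule ccontr)
    assume "\<not> ?thesis"
    with deg3[of v] have c3: "card (N v) = 3" by simp
    define W where "W = pverts G - insert v (N v)"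
    \<comment> \<open>Among the four vertices of \<open>insert x (N v)\<close> every edge meets
      \<open>x\<close>, since \<open>N v\<close> is independent; so \<open>x\<close> is the centre
      of the path found there.\<close>
    have two: "\<exists>a\<in>N v. \<exists>b\<in>N v. (x, a) \<in> parcs G \<and> (x, b) \<in> parcs G \<and> a \<noteq> b" if "x \<in> W" for x
    proof -
      have "card (insert x (N v)) = 4" "insert x (N v) \<subseteq> pverts G"
        using that c3 fin N_sub[of v] by (auto simp: W_def)
      from path[OF this(2,1)] show ?thesis
        using indep irr by blast
    qed
    obtain p q r where pqr: "N v = {p, q, r}"
      using c3 by (auto simp: card_3_iff)
    have "(x, y) \<notin> parcs G" if xy: "x \<in> W" "y \<in> W" for x y
    proof -
      \<comment> \<open>Two 2-subsets of the 3-set \<open>{p, q, r}\<close> intersect.\<close>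
      have "\<exists>c. (x, c) \<in> parcs G \<and> (y, c) \<in> parcs G"
        using two[OF xy(1)] two[OF xy(2)] unfolding pqr by blast
      then show ?thesis using tri sym by blast
    qed
    moreover have "(v, x) \<notin> parcs G" if "x \<in> W" for x
      using that by (auto simp: W_def N_def)
    moreover have "card (insert v W) = 4" "insert v W \<subseteq> pverts G"
      using card_W[OF v] c3 v pair_finite_verts by (auto simp: W_def)
    ultimately show False
      using path[of "insert v W"] irr sym by blast
  qed
  \<comment> \<open>Any 4-set serves here: it only supplies a vertex \<open>v\<close> with two
    distinct neighbours.\<close>
  obtain S where "S \<subseteq> pverts G" "card S = 4"
    using obtain_subset_with_card_n[of 4 "pverts G"] card7 by auto
  from path[OF this] \<open>S \<subseteq> pverts G\<close> obtain v a b where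
    v: "v \<in> pverts G" and ab: "(v, a) \<in> parcs G" "(v, b) \<in> parcs G" "a \<noteq> b" by blast
  have N_pair: "N u = {s, t}" if "u \<in> pverts G" "(u, s) \<in> parcs G" "(u, t) \<in> parcs G" "s \<noteq> t"
    for u s t
  proof (rule card_seteq[OF fin, symmetric])
    show "{s, t} \<subseteq> N u" using that by (auto simp: N_def)
    show "card (N u) \<le> card {s, t}" using that deg2[of u] by simp
  qed
  note Nv = N_pair[OF v ab]
  have "card (pverts G - insert v (N v)) = 4"
    using card_W[OF v] ab(3) by (simp add: Nv)
  then obtain x y z where xyz: "x \<in> pverts G - {v, a, b}" "y \<in> pverts G - {v, a, b}"
      "z \<in> pverts G - {v, a, b}" "(x, y) \<in> parcs G" "(x, z) \<in> parcs G" "y \<noteq> z"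
    using path[of "pverts G - insert v (N v)"] unfolding Nv by auto
  have Nx: "N x = {y, z}"
    using N_pair xyz by blast
  \<comment> \<open>Otherwise \<open>N y = {a, b}\<close>, but \<open>x\<close> is also a neighbour
    of \<open>y\<close> and lies outside \<open>{a, b}\<close>.\<close>
  have "(y, a) \<notin> parcs G \<or> (y, b) \<notin> parcs G"
    using N_pair[of y a b] xyz ab(3) sym[of x y] by (auto simp: N_def)
  then obtain c where c: "c \<in> {a, b}" "(y, c) \<notin> parcs G" by blast
  \<comment> \<open>The neighbourhoods of \<open>x\<close> and \<open>v\<close> are known exactly,
    so \<open>vc\<close> and \<open>xy\<close> are the only edges within
    \<open>{v, c, x, y}\<close>.\<close>
  have non: "(x, c) \<notin> parcs G" "(v, x) \<notin> parcs G" "(v, y) \<notin> parcs G"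
    using Nx Nv c xyz by (auto simp: N_def)
  have "x \<noteq> y" "v \<noteq> c" using xyz c ab irr by blast+
  then have "card {v, c, x, y} = 4" "{v, c, x, y} \<subseteq> pverts G"
    using c xyz v ab irr N_sub[of v] Nv by auto
  then show False
    using path[of "{v, c, x, y}"] non c sym irr by blast
qed

text \<open>The complete bipartite graph between the even and the odd numbers below
  \<open>n\<close>: \<open>n = 6\<close> gives \<open>K\<^sub>3\<^sub>,\<^sub>3\<close>, and smaller
  \<open>n\<close> give induced subgraphs of it.\<close>

definition parity_graph :: "nat \<Rightarrow> nat pair_pre_digraph" where
  "parity_graph n = \<lparr>pverts = {..<n}, parcs = {(u, v). u < n \<and> v < n \<and> even u \<noteq> even v}\<rparr>"

lemma pair_graph_parity_graph: "pair_graph (parity_graph n)"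
proof
  show "finite (parcs (parity_graph n))"
    by (rule finite_subset[of _ "{..<n} \<times> {..<n}"]) (auto simp: parity_graph_def)
  show "symmetric (with_proj (parity_graph n))"
    by (auto simp: symmetric_def parity_graph_def intro!: symI)
qed (auto simp: parity_graph_def)

lemma triangle_free_parity_graph: "triangle_free (parity_graph n)"
  by (auto simp: triangle_free_def parity_graph_def)

text \<open>Each parity class has at most three vertices, so a 4-set meets both. A vertex is
  adjacent to the whole opposite class, so sparseness leaves at most one vertex of each parity, two
  in all.\<close>

lemma parity_graph_no_1_sparse_4:
  assumes "n \<le> 6"
  shows "\<not> (\<exists>S. k_sparse 1 (parity_graph n) S \<and> card S = 4)"
proof
  assume "\<exists>S. k_sparse 1 (parity_graph n) S \<and> card S = 4"
  then obtain S where ks: "k_sparse 1 (parity_graph n) S" and card4: "card S = 4" by blast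
  note sp = ks[unfolded pair_graph.k_sparse_1_iff[OF pair_graph_parity_graph]]
  have sub: "S \<subseteq> {..<n}" using sp by (simp add: parity_graph_def)
  have sparse: "a = b"
    if "v \<in> S" "a \<in> S" "b \<in> S" "even v \<noteq> even a" "even v \<noteq> even b" for v a b
  proof -
    have "(v, a) \<in> parcs (parity_graph n)" "(v, b) \<in> parcs (parity_graph n)"
      using that sub by (auto simp: parity_graph_def)
    with sp that show ?thesis by blast
  qed
  have fin: "finite S" using sub finite_subset by blast
  define A where "A = {u \<in> S. even u}"
  define B where "B = {u \<in> S. odd u}"
  have finAB: "finite A" "finite B" using fin by (simp_all add: A_def B_def)
  have "S = A \<union> B" "A \<inter> B = {}" by (auto simp: A_def B_def)
  then have "card A + card B = 4"
    using card4 card_Un_disjoint[OF finAB] by simp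
  moreover have "card A \<le> 3"
  proof -
    have "u \<in> {0, 2, 4}" if "u \<in> A" for u
    proof -
      have "u < 6" "even u" using that sub assms by (auto simp: A_def)
      then show ?thesis unfolding insert_iff empty_iff by presburger
    qed
    then have "A \<subseteq> {0, 2, 4}" by (rule subsetI)
    then show ?thesis using card_mono[of "{0, 2, 4}" A] by simp
  qed
  moreover have "card B \<le> 3"
  proof -
    have "u \<in> {1, 3, 5}" if "u \<in> B" for u
    proof -
      have "u < 6" "odd u" using that sub assms by (auto simp: B_def)
      then show ?thesis unfolding insert_iff empty_iff by presburger
    qed
    then have "B \<subseteq> {1, 3, 5}" by (rule subsetI)
    then show ?thesis using card_mono[of "{1, 3, 5}" B] by simp
  qed
  moreover have "card A \<le> 1" if "B \<noteq> {}"
  proof -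
    from that obtain v where "v \<in> S" "odd v" by (auto simp: B_def)
    then have "\<forall>a\<in>A. \<forall>b\<in>A. a = b" using sparse[of v] by (simp add: A_def)
    then show ?thesis using card_le_Suc0_iff_eq[OF finAB(1)] by simp
  qed
  moreover have "card B \<le> 1" if "A \<noteq> {}"
  proof -
    from that obtain v where "v \<in> S" "even v" by (auto simp: A_def)
    then have "\<forall>a\<in>B. \<forall>b\<in>B. a = b" using sparse[of v] by (simp add: B_def)
    then show ?thesis using card_le_Suc0_iff_eq[OF finAB(2)] by simp
  qed
  ultimately show False by (cases "A = {}"; cases "B = {}") simp_all
qed

theorem theorem3p1:
  shows "T_num 1 4 = 7 \<and>
    (\<forall>G :: 'a pair_pre_digraph.
       pair_graph G \<and> triangle_free G \<and> card (pverts G) = 7 \<longrightarrow>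
         (\<exists>S. k_sparse 1 G S \<and> card S = 4)) \<and>
    (\<exists>G :: nat pair_pre_digraph.
       pair_graph G \<and> triangle_free G \<and> card (pverts G) = 6 \<and>
         \<not> (\<exists>S. k_sparse 1 G S \<and> card S = 4))"
proof -
  \<comment> \<open>Minimality requires a counterexample for every \<open>n \<le> 6\<close>, as
    nothing is shown about monotonicity in \<open>n\<close>.\<close>
  have lower: "pair_graph (parity_graph n) \<and> triangle_free (parity_graph n) \<and>
      card (pverts (parity_graph n)) = n \<and> \<not> (\<exists>S. k_sparse 1 (parity_graph n) S \<and> card S = 4)"
    if "n \<le> 6" for n
    using pair_graph_parity_graph triangle_free_parity_graph parity_graph_no_1_sparse_4[OF that]
    by (simp add: parity_graph_def)
  have "T_num 1 4 = 7"
    unfolding T_num_def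
  proof (rule Least_equality)
    fix n :: nat
    assume "\<forall>G :: nat pair_pre_digraph. pair_graph G \<and> triangle_free G \<and> card (pverts G) = n \<longrightarrow>
      (\<exists>S. k_sparse 1 G S \<and> card S = 4)"
    with lower[of n] have "\<not> n \<le> 6" by blast
    then show "7 \<le> n" by simp
  qed (blast intro: pair_graph.ex_1_sparse_4_of_7)
  \<comment> \<open>\<open>T_num\<close> ranges over graphs on \<open>nat\<close> only, so the upper
    bound is applied again for vertices of type \<open>'a\<close>.\<close>
  then show ?thesis
    using lower[of 6] pair_graph.ex_1_sparse_4_of_7 by blast
qed

end
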